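(* Let $n\ge 1$ and let $\mathcal{D}_{\mathcal{F}}$ be the Fibonacci derivation of $\mathbb{C}[x_0,x_1,\ldots,x_n]$. Then $$\ker\mathcal{D}_{\mathcal{F}}=\mathbb{C}[x_0,x_1,C_3,C_4,\ldots,C_n][x_1^{-1}]\cap\mathbb{C}[x_0,x_1,\ldots,x_n],$$ where, for $3\le m\le n$, $$C_m=x_m x_1^{m-2}+\sum_{k=1}^{m-3}\frac1k\sum_{i=0}^{\lfloor (m-k)/2\rfloor}(-1)^{k+i}(m-k-2i)\binom{i+k-1}{k-1}\binom{m-i-1}{k-1}x_{m-k-2i}\,x_2^k\,x_1^{m-2-k}+(m-2)(-1)^{m-2}x_2^{m-1}.$$ The intersection is taken inside $\mathbb{C}[x_0,\ldots,x_n][x_1^{-1}]$.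
   Context: The Fibonacci derivation $\mathcal{D}_{\mathcal{F}}$ is the $\mathbb{C}$-linear derivation of $\mathbb{C}[x_0,\ldots,x_n]$ determined by $\mathcal{D}_{\mathcal{F}}(x_0)=\mathcal{D}_{\mathcal{F}}(x_1)=0$ and $\mathcal{D}_{\mathcal{F}}(x_m)=\sum_{k=0}^{\lfloor (m-1)/2\rfloor}(-1)^k(m-1-2k)\,x_{m-1-2k}$ for $2\le m\le n$. Its kernel is $\ker\mathcal{D}_{\mathcal{F}}=\{f\in\mathbb{C}[x_0,\ldots,x_n]: \mathcal{D}_{\mathcal{F}}(f)=0\}$. The list $C_3,\ldots,C_n$ is empty when $n<3$, and an empty sum is $0$. *)

theory Defs
  imports
    Complex_Main
    "HOL-Library.Poly_Mapping"
    "HOL-Computational_Algebra.Polynomial_Factorial"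
begin

text \<open>
  Polynomials over the complex numbers in the variables $x_0, x_1, x_2, \ldots$: an exponent vector
  is a finitely supported function \<^typ>\<open>nat \<Rightarrow>\<^sub>0 nat\<close>, a polynomial is a finitely
  supported function from exponent vectors to coefficients, and multiplication is convolution.
\<close>

type_synonym cpoly = "(nat \<Rightarrow>\<^sub>0 nat) \<Rightarrow>\<^sub>0 complex"

definition Const :: "complex \<Rightarrow> cpoly" where
  "Const c = Poly_Mapping.single 0 c"

definition X :: "nat \<Rightarrow> cpoly" where
  "X i = Poly_Mapping.single (Poly_Mapping.single i 1) 1"

text \<open>The subring of polynomials in which only $x_0, \ldots, x_n$ occur:\<close>

definition cpolys :: "nat \<Rightarrow> cpoly set" where
  "cpolys n = {f. \<forall>t \<in> Poly_Mapping.keys f. Poly_Mapping.keys t \<subseteq> {0..n}}"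

text \<open>For a subring \<open>A\<close> of a commutative ring, \<open>ring_adjoin A S\<close> is $A[S]$, the least subring
  containing \<open>A\<close> and \<open>S\<close>. (It has 0 and 1 because \<open>A\<close> does.) The rings $A[x_1^{-1}]$ are taken
  inside the fraction field \<^typ>\<open>cpoly fract\<close>, which contains $\mathbf{C}[x_0, \ldots, x_n][x_1^{-1}]$;
  polynomials are embedded by \<^const>\<open>to_fract\<close>.\<close>

inductive_set ring_adjoin :: "'a::comm_ring_1 set \<Rightarrow> 'a set \<Rightarrow> 'a set" for A S where
  base: "a \<in> A \<Longrightarrow> a \<in> ring_adjoin A S"
| gen: "s \<in> S \<Longrightarrow> s \<in> ring_adjoin A S"
| add: "a \<in> ring_adjoin A S \<Longrightarrow> b \<in> ring_adjoin A S \<Longrightarrow> a + b \<in> ring_adjoin A S"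
| uminus: "a \<in> ring_adjoin A S \<Longrightarrow> - a \<in> ring_adjoin A S"
| mult: "a \<in> ring_adjoin A S \<Longrightarrow> b \<in> ring_adjoin A S \<Longrightarrow> a * b \<in> ring_adjoin A S"

text \<open>Complex-linear derivations of $\mathbf{C}[x_0, \ldots, x_n]$; the values of \<open>D\<close> outside
  \<^term>\<open>cpolys n\<close> are irrelevant.\<close>

definition is_derivation :: "nat \<Rightarrow> (cpoly \<Rightarrow> cpoly) \<Rightarrow> bool" where
  "is_derivation n D \<longleftrightarrow>
     (\<forall>f \<in> cpolys n. D f \<in> cpolys n) \<and>
     (\<forall>f \<in> cpolys n. \<forall>g \<in> cpolys n. D (f + g) = D f + D g) \<and>
     (\<forall>c. \<forall>f \<in> cpolys n. D (Const c * f) = Const c * D f) \<and>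
     (\<forall>f \<in> cpolys n. \<forall>g \<in> cpolys n. D (f * g) = D f * g + f * D g)"

text \<open>The truncated subtractions on \<^typ>\<open>nat\<close> below never truncate in the stated ranges
  (\<open>m \<ge> 2\<close> here, \<open>m \<ge> 3\<close> in \<open>Cpoly\<close>).\<close>

definition fibonacci_derivation :: "nat \<Rightarrow> (cpoly \<Rightarrow> cpoly) \<Rightarrow> bool" where
  "fibonacci_derivation n D \<longleftrightarrow>
     is_derivation n D \<and> D (X 0) = 0 \<and> D (X 1) = 0 \<and>
     (\<forall>m \<in> {2..n}. D (X m) =
        (\<Sum>k = 0..(m - 1) div 2. (-1) ^ k * of_nat (m - 1 - 2 * k) * X (m - 1 - 2 * k)))"

definition derivation_kernel :: "nat \<Rightarrow> (cpoly \<Rightarrow> cpoly) \<Rightarrow> cpoly set" where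
  "derivation_kernel n D = {f \<in> cpolys n. D f = 0}"

definition Cpoly :: "nat \<Rightarrow> cpoly" where
  "Cpoly m =
     X m * X 1 ^ (m - 2)
     + (\<Sum>k = 1..m - 3. Const (1 / of_nat k) *
          (\<Sum>i = 0..(m - k) div 2.
             (-1) ^ (k + i) * of_nat (m - k - 2 * i)
             * of_nat ((i + k - 1) choose (k - 1)) * of_nat ((m - i - 1) choose (k - 1))
             * X (m - k - 2 * i) * X 2 ^ k * X 1 ^ (m - 2 - k)))
     + of_nat (m - 2) * (-1) ^ (m - 2) * X 2 ^ (m - 1)"

text \<open>
  The rest of the theory checks the definitions: \<^term>\<open>cpolys n\<close> is generated by the
  constants and $x_0, \ldots, x_n$, and for \<open>n \<ge> 1\<close> there is exactly one Fibonacci derivation on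
  \<^term>\<open>cpolys n\<close>.
\<close>

lemma Const_add: "Const (a + b) = Const a + Const b"
  by (simp add: Const_def single_add)

lemma Const_mult: "Const (a * b) = Const a * Const b"
  by (simp add: Const_def mult_single)

lemma Const_0 [simp]: "Const 0 = 0" and Const_1 [simp]: "Const 1 = 1"
  by (simp_all add: Const_def)

lemma Const_of_nat: "Const (of_nat m) = of_nat m"
  by (induction m) (simp_all add: Const_add)

lemma cpolys_Const [simp]: "Const c \<in> cpolys n"
  by (auto simp: cpolys_def Const_def)

lemma cpolys_X: "i \<le> n \<Longrightarrow> X i \<in> cpolys n"
  by (auto simp: cpolys_def X_def)

lemma cpolys_0 [simp]: "0 \<in> cpolys n" and cpolys_1 [simp]: "1 \<in> cpolys n"
  using cpolys_Const[of 0 n] cpolys_Const[of 1 n] by simp_all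

lemma cpolys_of_nat [simp]: "of_nat m \<in> cpolys n"
  by (metis Const_of_nat cpolys_Const)

lemma cpolys_add: "f \<in> cpolys n \<Longrightarrow> g \<in> cpolys n \<Longrightarrow> f + g \<in> cpolys n"
  unfolding cpolys_def using keys_add[of f g] by blast

lemma cpolys_uminus: "f \<in> cpolys n \<Longrightarrow> - f \<in> cpolys n"
  by (simp add: cpolys_def)

lemma cpolys_mult:
  assumes "f \<in> cpolys n" "g \<in> cpolys n"
  shows "f * g \<in> cpolys n"
proof -
  have "Poly_Mapping.keys t \<subseteq> {0..n}" if t: "t \<in> Poly_Mapping.keys (f * g)" for t
  proof -
    obtain a b where "t = a + b" "a \<in> Poly_Mapping.keys f" "b \<in> Poly_Mapping.keys g"
      using keys_mult[of f g] t by blast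
    then show ?thesis
      using assms keys_add[of a b] unfolding cpolys_def by blast
  qed
  then show ?thesis
    by (simp add: cpolys_def)
qed

lemma cpolys_sum: "(\<And>i. i \<in> I \<Longrightarrow> f i \<in> cpolys n) \<Longrightarrow> sum f I \<in> cpolys n"
  by (induction I rule: infinite_finite_induct) (auto intro: cpolys_add)

lemma cpolys_power: "f \<in> cpolys n \<Longrightarrow> f ^ k \<in> cpolys n"
  by (induction k) (auto intro: cpolys_mult)

lemma sum_singles:
  "(\<Sum>t \<in> Poly_Mapping.keys f. Poly_Mapping.single t (Poly_Mapping.lookup f t)) = f"
  for f :: "'a \<Rightarrow>\<^sub>0 'b::comm_monoid_add"
proof (rule poly_mapping_eqI)
  fix s
  have "Poly_Mapping.lookup (\<Sum>t \<in> Poly_Mapping.keys f.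
        Poly_Mapping.single t (Poly_Mapping.lookup f t)) s =
      (\<Sum>t \<in> Poly_Mapping.keys f. if t = s then Poly_Mapping.lookup f s else 0)"
    unfolding lookup_sum by (intro sum.cong) (auto simp: lookup_single when_def)
  then show "Poly_Mapping.lookup (\<Sum>t \<in> Poly_Mapping.keys f.
      Poly_Mapping.single t (Poly_Mapping.lookup f t)) s = Poly_Mapping.lookup f s"
    by (simp add: in_keys_iff)
qed

lemma cpoly_expand:
  "f = (\<Sum>t \<in> Poly_Mapping.keys f. Const (Poly_Mapping.lookup f t) * Poly_Mapping.single t 1)"
  for f :: cpoly
  by (simp add: Const_def mult_single sum_singles)

lemma single_eq_prod_X:
  "Poly_Mapping.single t 1 = (\<Prod>i \<in> Poly_Mapping.keys t. X i ^ Poly_Mapping.lookup t i)"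
proof -
  have pow: "X i ^ k = Poly_Mapping.single (Poly_Mapping.single i k) 1" for i k
    by (induction k) (simp_all add: X_def mult_single flip: single_add)
  have pr: "(\<Prod>i\<in>I. Poly_Mapping.single (h i) 1) =
      (Poly_Mapping.single (sum h I) 1 :: cpoly)" if "finite I"
    for I :: "nat set" and h
    using that by (induction I rule: finite_induct) (simp_all add: mult_single)
  show ?thesis
    by (simp add: pow pr sum_singles)
qed

theorem cpolys_eq_ring_adjoin: "cpolys n = ring_adjoin (range Const) (X ` {0..n})"
proof (intro equalityI subsetI)
  fix f assume "f \<in> ring_adjoin (range Const) (X ` {0..n})"
  then show "f \<in> cpolys n"
    by induction (auto intro: cpolys_X cpolys_add cpolys_uminus cpolys_mult)
next
  fix f assume f: "f \<in> cpolys n"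
  let ?R = "ring_adjoin (range Const) (X ` {0..n})"
  have C: "Const c \<in> ?R" for c
    by (auto intro: ring_adjoin.base)
  have 0: "0 \<in> ?R" and 1: "1 \<in> ?R"
    using C[of 0] C[of 1] by simp_all
  have pow: "g ^ k \<in> ?R" if "g \<in> ?R" for g k
    using that by (induction k) (auto intro: 1 ring_adjoin.mult)
  have prod: "prod h I \<in> ?R" if "\<And>i. i \<in> I \<Longrightarrow> h i \<in> ?R" for h :: "nat \<Rightarrow> cpoly" and I
    using that by (induction I rule: infinite_finite_induct) (auto intro: 1 ring_adjoin.mult)
  have sm: "sum h I \<in> ?R" if "\<And>i. i \<in> I \<Longrightarrow> h i \<in> ?R"
    for h :: "(nat \<Rightarrow>\<^sub>0 nat) \<Rightarrow> cpoly" and I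
    using that by (induction I rule: infinite_finite_induct) (auto intro: 0 ring_adjoin.add)
  have "Poly_Mapping.single t 1 \<in> ?R" if "t \<in> Poly_Mapping.keys f" for t
  proof -
    have "Poly_Mapping.keys t \<subseteq> {0..n}"
      using f that by (auto simp: cpolys_def)
    then show ?thesis
      unfolding single_eq_prod_X by (intro prod pow ring_adjoin.gen) auto
  qed
  then show "f \<in> ?R"
    by (subst cpoly_expand) (intro sm ring_adjoin.mult C)
qed

lemma derivation_Const:
  assumes "is_derivation n D"
  shows "D (Const c) = 0"
proof -
  have "D (1 * 1) = D 1 * 1 + 1 * D 1"
    using assms unfolding is_derivation_def by (metis cpolys_1)
  then have "D 1 = 0"
    by simp
  moreover have "D (Const c * 1) = Const c * D 1"
    using assms unfolding is_derivation_def by (metis cpolys_1)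
  ultimately show ?thesis
    by simp
qed

lemma derivation_unique:
  assumes D: "is_derivation n D" and E: "is_derivation n E"
    and eq: "\<And>i. i \<le> n \<Longrightarrow> D (X i) = E (X i)" and f: "f \<in> cpolys n"
  shows "D f = E f"
  using f unfolding cpolys_eq_ring_adjoin
proof induction
  case (base a)
  then show ?case
    using derivation_Const[OF D] derivation_Const[OF E] by auto
next
  case (gen s)
  then show ?case
    using eq by auto
next
  case (add a b)
  then show ?case
    using D E unfolding cpolys_eq_ring_adjoin[symmetric] is_derivation_def by simp
next
  case (uminus a)
  have "- a = Const (-1) * a"
    by (simp add: Const_def single_uminus)
  moreover have "D (Const (-1) * a) = Const (-1) * D a" "E (Const (-1) * a) = Const (-1) * E a"
    using D E uminus(1) unfolding cpolys_eq_ring_adjoin[symmetric] is_derivation_def by blast+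
  ultimately show ?case
    using uminus(2) by simp
next
  case (mult a b)
  then show ?case
    using D E unfolding cpolys_eq_ring_adjoin[symmetric] is_derivation_def by simp
qed

theorem fibonacci_derivation_unique:
  assumes D: "fibonacci_derivation n D" and E: "fibonacci_derivation n E" and f: "f \<in> cpolys n"
  shows "D f = E f"
proof (rule derivation_unique[OF _ _ _ f])
  show "D (X i) = E (X i)" if "i \<le> n" for i
  proof -
    have "i = 0 \<or> i = 1 \<or> i \<in> {2..n}"
      using that by auto
    then show ?thesis
      using D E by (auto simp: fibonacci_derivation_def)
  qed
qed (use D E in \<open>simp_all add: fibonacci_derivation_def\<close>)

text \<open>Existence: \<open>monomial_derivation a n t\<close> is the value at the monomial \<open>t\<close> of the derivation
  with values \<open>a j\<close> at the variables $x_j$, $j \le n$.\<close>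

definition monomial_derivation :: "(nat \<Rightarrow> cpoly) \<Rightarrow> nat \<Rightarrow> (nat \<Rightarrow>\<^sub>0 nat) \<Rightarrow> cpoly" where
  "monomial_derivation a n t =
     (\<Sum>j = 0..n. of_nat (Poly_Mapping.lookup t j)
        * Poly_Mapping.single (t - Poly_Mapping.single j 1) 1 * a j)"

definition derivation_of :: "(nat \<Rightarrow> cpoly) \<Rightarrow> nat \<Rightarrow> cpoly \<Rightarrow> cpoly" where
  "derivation_of a n f =
     (\<Sum>t \<in> Poly_Mapping.keys f. Const (Poly_Mapping.lookup f t) * monomial_derivation a n t)"

lemma derivation_of_superset:
  assumes "finite T" "Poly_Mapping.keys f \<subseteq> T"
  shows "derivation_of a n f =
     (\<Sum>t \<in> T. Const (Poly_Mapping.lookup f t) * monomial_derivation a n t)"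
  unfolding derivation_of_def using assms
  by (intro sum.mono_neutral_left) (auto simp: in_keys_iff)

lemma derivation_of_add: "derivation_of a n (f + g) = derivation_of a n f + derivation_of a n g"
proof -
  let ?T = "Poly_Mapping.keys f \<union> Poly_Mapping.keys g"
  have "finite ?T" "Poly_Mapping.keys (f + g) \<subseteq> ?T"
    using keys_add[of f g] by auto
  then show ?thesis
    using derivation_of_superset[of ?T "f + g" a n] derivation_of_superset[of ?T f a n]
      derivation_of_superset[of ?T g a n]
    by (simp add: lookup_add Const_add distrib_right sum.distrib)
qed

lemma derivation_of_0 [simp]: "derivation_of a n 0 = 0"
  by (simp add: derivation_of_def)

lemma derivation_of_sum: "derivation_of a n (sum h I) = (\<Sum>i\<in>I. derivation_of a n (h i))"
  by (induction I rule: infinite_finite_induct) (simp_all add: derivation_of_add)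

lemma derivation_of_single:
  "derivation_of a n (Poly_Mapping.single t c) = Const c * monomial_derivation a n t"
  by (simp add: derivation_of_def)

lemma of_nat_single_shift:
  "of_nat (Poly_Mapping.lookup s j)
      * Poly_Mapping.single (s + t - Poly_Mapping.single j 1) (1::complex)
   = of_nat (Poly_Mapping.lookup s j)
      * (Poly_Mapping.single (s - Poly_Mapping.single j 1) 1 * Poly_Mapping.single t 1)"
proof (cases "Poly_Mapping.lookup s j = 0")
  case False
  have "s + t - Poly_Mapping.single j 1 = (s - Poly_Mapping.single j 1) + t"
    using False
    by (intro poly_mapping_eqI) (auto simp: lookup_add lookup_minus lookup_single when_def)
  then show ?thesis
    by (simp add: mult_single)
qed simp

lemma monomial_derivation_add:
  "monomial_derivation a n (s + t) =
     monomial_derivation a n s * Poly_Mapping.single t 1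
     + Poly_Mapping.single s 1 * monomial_derivation a n t"
proof -
  have "of_nat (Poly_Mapping.lookup (s + t) j)
        * Poly_Mapping.single (s + t - Poly_Mapping.single j 1) 1 * a j =
      of_nat (Poly_Mapping.lookup s j)
        * Poly_Mapping.single (s - Poly_Mapping.single j 1) 1 * a j * Poly_Mapping.single t 1
      + Poly_Mapping.single s 1 * (of_nat (Poly_Mapping.lookup t j)
        * Poly_Mapping.single (t - Poly_Mapping.single j 1) 1 * a j)" for j
  proof -
    have "of_nat (Poly_Mapping.lookup (s + t) j)
          * Poly_Mapping.single (s + t - Poly_Mapping.single j 1) 1 * a j =
        of_nat (Poly_Mapping.lookup s j)
          * Poly_Mapping.single (s + t - Poly_Mapping.single j 1) 1 * a j
        + of_nat (Poly_Mapping.lookup t j)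
          * Poly_Mapping.single (t + s - Poly_Mapping.single j 1) 1 * a j"
      by (simp add: lookup_add distrib_right add.commute[of t s])
    then show ?thesis
      unfolding of_nat_single_shift by (simp only: mult_ac)
  qed
  then show ?thesis
    by (simp add: monomial_derivation_def sum.distrib sum_distrib_left sum_distrib_right)
qed

lemma derivation_of_mult:
  "derivation_of a n (f * g) = derivation_of a n f * g + f * derivation_of a n g"
proof -
  have single: "derivation_of a n (Poly_Mapping.single s c * Poly_Mapping.single t d) =
      derivation_of a n (Poly_Mapping.single s c) * Poly_Mapping.single t d
      + Poly_Mapping.single s c * derivation_of a n (Poly_Mapping.single t d)" for s t c d
  proof -
    have eq: "Poly_Mapping.single s c = Const c * Poly_Mapping.single s 1"
      "Poly_Mapping.single t d = Const d * Poly_Mapping.single t 1"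
      by (simp_all add: Const_def mult_single)
    have "derivation_of a n (Poly_Mapping.single s c * Poly_Mapping.single t d) =
        Const c * Const d * (monomial_derivation a n s * Poly_Mapping.single t 1
          + Poly_Mapping.single s 1 * monomial_derivation a n t)"
      by (simp add: mult_single derivation_of_single Const_mult monomial_derivation_add)
    also have "\<dots> = (Const c * monomial_derivation a n s) * (Const d * Poly_Mapping.single t 1)
        + (Const c * Poly_Mapping.single s 1) * (Const d * monomial_derivation a n t)"
      by (simp add: algebra_simps)
    finally show ?thesis
      by (simp only: eq[symmetric] derivation_of_single)
  qed
  define F where "F t = Poly_Mapping.single t (Poly_Mapping.lookup f t)" for t
  define G where "G t = Poly_Mapping.single t (Poly_Mapping.lookup g t)" for t
  have f: "f = sum F (Poly_Mapping.keys f)" and g: "g = sum G (Poly_Mapping.keys g)"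
    by (simp_all add: F_def G_def sum_singles)
  have "derivation_of a n (sum F I * sum G J) =
      derivation_of a n (sum F I) * sum G J + sum F I * derivation_of a n (sum G J)" for I J
    unfolding sum_product derivation_of_sum
    by (simp add: F_def G_def single sum.distrib)
  then show ?thesis
    using f g by metis
qed

lemma monomial_derivation_cpolys:
  assumes "\<And>j. j \<le> n \<Longrightarrow> a j \<in> cpolys n" "Poly_Mapping.keys t \<subseteq> {0..n}"
  shows "monomial_derivation a n t \<in> cpolys n"
proof -
  have "Poly_Mapping.single (t - Poly_Mapping.single j 1) 1 \<in> cpolys n" for j
  proof -
    have "Poly_Mapping.keys (t - Poly_Mapping.single j 1) \<subseteq> Poly_Mapping.keys t"
      by (auto simp: in_keys_iff lookup_minus)
    then show ?thesis
      using assms(2) by (auto simp: cpolys_def)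
  qed
  then show ?thesis
    unfolding monomial_derivation_def
    by (intro cpolys_sum cpolys_mult cpolys_of_nat assms(1)) auto
qed

lemma is_derivation_derivation_of:
  assumes "\<And>j. j \<le> n \<Longrightarrow> a j \<in> cpolys n"
  shows "is_derivation n (derivation_of a n)"
proof -
  have zero: "derivation_of a n (Const c) = 0" for c
    by (simp add: Const_def derivation_of_single monomial_derivation_def)
  have "derivation_of a n f \<in> cpolys n" if "f \<in> cpolys n" for f
    unfolding derivation_of_def using that assms
    by (intro cpolys_sum cpolys_mult cpolys_Const monomial_derivation_cpolys)
      (auto simp: cpolys_def)
  then show ?thesis
    by (simp add: is_derivation_def derivation_of_add derivation_of_mult zero)
qed

lemma derivation_of_X:
  assumes "i \<le> n"
  shows "derivation_of a n (X i) = a i"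
proof -
  have "monomial_derivation a n (Poly_Mapping.single i 1) = (\<Sum>j = 0..n. if j = i then a j else 0)"
    unfolding monomial_derivation_def by (intro sum.cong) (auto simp: lookup_single)
  then show ?thesis
    using assms by (simp add: X_def derivation_of_single)
qed

theorem fibonacci_derivation_exists:
  assumes "1 \<le> n"
  shows "\<exists>D. fibonacci_derivation n D"
proof
  define a :: "nat \<Rightarrow> cpoly" where "a m = (if m < 2 then 0 else
    (\<Sum>k = 0..(m - 1) div 2. (-1) ^ k * of_nat (m - 1 - 2 * k) * X (m - 1 - 2 * k)))" for m
  have "a m \<in> cpolys n" if "m \<le> n" for m
    using that unfolding a_def
    by (auto simp del: of_nat_diff
        intro!: cpolys_sum cpolys_mult cpolys_of_nat cpolys_power cpolys_X cpolys_uminus)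
  then show "fibonacci_derivation n (derivation_of a n)"
    using assms is_derivation_derivation_of[of n a]
    by (auto simp: fibonacci_derivation_def derivation_of_X a_def)
qed

end

theory Submission
  imports Defs
begin

text \<open>
  Write $D$ for the Fibonacci derivation and $A = \mathbf{C}[x_0, x_1, C_3, \ldots, C_n]$. For
  $n \ge 2$ the element $x_2$ is a local slice: $D(x_2) = x_1 \ne 0$ and $D(x_1) = 0$. For every
  derivation of a domain of characteristic 0, an element $s$ with $D(s) \ne 0$ is transcendental
  over the kernel (\<open>transcendental_over_kernel\<close>), because $D$ acts on polynomials in $s$ over the
  kernel as $D(s)$ times the formal derivative. So a polynomial in $s$ over the
  kernel that is killed by $D$ is constant (\<open>kernel_poly_value\<close>).

  After inversion of $x_1$, the formula
  $\sum_k \frac{(-1)^k}{k!} D^k(f) \left(\frac{x_2}{x_1}\right)^k$ sends $f$ into the kernel, and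
  $C_m$ is its value at $x_m$, times $x_1^{m-2}$. What makes this explicit is a closed form for
  $D^k(x_m)$ (\<open>scaled_iterate\<close>), which rests on one summation of binomial products
  (\<open>sum_choose_product\<close>). With it, $D(C_m)$ is a telescoping sum with value 0, so $A$ lies in the
  kernel, and with $A$ every polynomial $f$ such that $x_1^N f \in A$ for some $N$.

  Conversely, $C_m$ is $x_1^{m-2} x_m$ plus a polynomial in variables with smaller index. By
  induction on $m$, every $f \in \mathbf{C}[x_0, \ldots, x_n]$ therefore becomes a polynomial in
  $x_2$ over $A$ after multiplication by a power of $x_1$. If $D(f) = 0$, that polynomial is
  constant, that is, $x_1^N f \in A$. By \<open>to_fract_mem_localisation_iff\<close> this is
  the membership of $f$ in $A[x_1^{-1}]$.
\<close>

section \<open>Subrings and localisation\<close>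

definition is_subring :: "'a::comm_ring_1 set \<Rightarrow> bool" where
  "is_subring R \<longleftrightarrow> 1 \<in> R \<and> (\<forall>a\<in>R. \<forall>b\<in>R. a + b \<in> R \<and> a * b \<in> R) \<and> (\<forall>a\<in>R. - a \<in> R)"

lemma is_subringI:
  assumes "1 \<in> R" "\<And>a b. a \<in> R \<Longrightarrow> b \<in> R \<Longrightarrow> a + b \<in> R"
    "\<And>a b. a \<in> R \<Longrightarrow> b \<in> R \<Longrightarrow> a * b \<in> R" "\<And>a. a \<in> R \<Longrightarrow> - a \<in> R"
  shows "is_subring R"
  using assms by (auto simp: is_subring_def)

lemma is_subringD:
  assumes "is_subring R"
  shows "1 \<in> R" "a \<in> R \<Longrightarrow> b \<in> R \<Longrightarrow> a + b \<in> R"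
    "a \<in> R \<Longrightarrow> b \<in> R \<Longrightarrow> a * b \<in> R" "a \<in> R \<Longrightarrow> - a \<in> R"
  using assms by (auto simp: is_subring_def)

lemma is_subring_zero: "is_subring R \<Longrightarrow> 0 \<in> R"
  by (metis is_subringD(1,2,4) add.right_inverse)

lemma is_subring_diff: "is_subring R \<Longrightarrow> a \<in> R \<Longrightarrow> b \<in> R \<Longrightarrow> a - b \<in> R"
  by (metis is_subringD(2,4) diff_conv_add_uminus)

lemma is_subring_power: "is_subring R \<Longrightarrow> a \<in> R \<Longrightarrow> a ^ k \<in> R"
  by (induction k) (auto intro: is_subringD)

lemma is_subring_of_nat: "is_subring R \<Longrightarrow> of_nat k \<in> R"
  by (induction k) (auto intro: is_subringD is_subring_zero)

lemma is_subring_sum: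
  assumes "is_subring R" "\<And>i. i \<in> I \<Longrightarrow> f i \<in> R"
  shows "sum f I \<in> R"
  using assms(2)
  by (induction I rule: infinite_finite_induct)
    (auto intro: is_subringD(2)[OF assms(1)] is_subring_zero[OF assms(1)])

lemma is_subring_ring_adjoin: "1 \<in> B \<Longrightarrow> is_subring (ring_adjoin B S)"
  by (intro is_subringI) (auto intro: ring_adjoin.intros)

lemma ring_adjoin_least:
  assumes "is_subring R" "B \<subseteq> R" "S \<subseteq> R"
  shows "ring_adjoin B S \<subseteq> R"
proof
  fix a assume "a \<in> ring_adjoin B S"
  then show "a \<in> R"
    by induction (use assms in \<open>auto intro: is_subringD\<close>)
qed

text \<open>If \<open>u\<close> is not a zero divisor, this set is the intersection of the localisation $R[u^{-1}]$
  with the ambient ring, phrased without fractions. As a subring, it lets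
  generators be cleared of powers of $u$ one at a time.\<close>

lemma is_subring_clear_denominators:
  assumes R: "is_subring R" and u: "u \<in> R"
  shows "is_subring {f. \<exists>N. u ^ N * f \<in> R}"
proof (rule is_subringI)
  have "u ^ 0 * 1 \<in> R"
    using is_subringD(1)[OF R] by simp
  then show "1 \<in> {f. \<exists>N. u ^ N * f \<in> R}"
    by blast
next
  fix a b assume "a \<in> {f. \<exists>N. u ^ N * f \<in> R}" "b \<in> {f. \<exists>N. u ^ N * f \<in> R}"
  then obtain M N where M: "u ^ M * a \<in> R" and N: "u ^ N * b \<in> R"
    by blast
  have "u ^ N * (u ^ M * a) + u ^ M * (u ^ N * b) \<in> R"
    by (intro is_subringD[OF R] is_subring_power[OF R] u M N)
  then have "u ^ (M + N) * (a + b) \<in> R"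
    by (simp add: power_add algebra_simps)
  then show "a + b \<in> {f. \<exists>N. u ^ N * f \<in> R}"
    by blast
  have "(u ^ M * a) * (u ^ N * b) \<in> R"
    by (intro is_subringD[OF R] M N)
  then have "u ^ (M + N) * (a * b) \<in> R"
    by (simp add: power_add algebra_simps)
  then show "a * b \<in> {f. \<exists>N. u ^ N * f \<in> R}"
    by blast
next
  fix a assume "a \<in> {f. \<exists>N. u ^ N * f \<in> R}"
  then obtain N where "u ^ N * a \<in> R"
    by blast
  then have "u ^ N * (- a) \<in> R"
    using is_subringD(4)[OF R] by fastforce
  then show "- a \<in> {f. \<exists>N. u ^ N * f \<in> R}"
    by blast
qed

lemma to_fract_power: "to_fract (a ^ k) = to_fract a ^ k"
  by (induction k) simp_all

text \<open>Every element of $R[u^{-1}]$ has a power of $u$ as denominator, which turns membership in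
  the localisation into a statement inside the ring itself. The fractions with such a denominator
  form a subring that contains $R$ and $u^{-1}$, hence all of $R[u^{-1}]$.\<close>

lemma to_fract_mem_localisation_iff:
  fixes u :: "'a::idom"
  assumes R: "is_subring R" and u: "u \<in> R" "u \<noteq> 0"
  shows "to_fract f \<in> ring_adjoin (to_fract ` R) {inverse (to_fract u)}
    \<longleftrightarrow> (\<exists>N. u ^ N * f \<in> R)"
proof
  let ?L = "ring_adjoin (to_fract ` R) {inverse (to_fract u)}"
  have Rf: "is_subring (to_fract ` R)"
  proof (rule is_subringI)
    show "1 \<in> to_fract ` R"
      using is_subringD(1)[OF R] by (metis imageI to_fract_1)
  qed (auto intro: is_subringD[OF R] simp flip: to_fract_add to_fract_mult to_fract_uminus)
  have "is_subring {g. \<exists>N. to_fract u ^ N * g \<in> to_fract ` R}"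
    using u by (intro is_subring_clear_denominators[OF Rf]) simp
  moreover have "to_fract ` R \<subseteq> {g. \<exists>N. to_fract u ^ N * g \<in> to_fract ` R}"
    by (auto intro: exI[of _ 0])
  moreover have "to_fract u ^ 1 * inverse (to_fract u) \<in> to_fract ` R"
    using u is_subringD(1)[OF Rf] by simp
  ultimately have "?L \<subseteq> {g. \<exists>N. to_fract u ^ N * g \<in> to_fract ` R}"
    by (intro ring_adjoin_least) blast+
  moreover assume "to_fract f \<in> ?L"
  ultimately obtain N where "to_fract u ^ N * to_fract f \<in> to_fract ` R"
    by blast
  then have "to_fract (u ^ N * f) \<in> to_fract ` R"
    by (simp only: to_fract_power to_fract_mult)
  then obtain a where "to_fract (u ^ N * f) = to_fract a" "a \<in> R"
    by blast
  then show "\<exists>N. u ^ N * f \<in> R"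
    by (auto simp only: to_fract_eq_iff)
next
  let ?L = "ring_adjoin (to_fract ` R) {inverse (to_fract u)}"
  have L: "is_subring ?L"
    using is_subringD(1)[OF R] by (intro is_subring_ring_adjoin) (metis imageI to_fract_1)
  assume "\<exists>N. u ^ N * f \<in> R"
  then obtain N where N: "u ^ N * f \<in> R"
    by blast
  have "inverse (to_fract u) ^ N * to_fract (u ^ N * f) \<in> ?L"
    by (rule is_subringD(3)[OF L is_subring_power[OF L ring_adjoin.gen]
          ring_adjoin.base[OF imageI[OF N]]]) simp
  moreover have "inverse (to_fract u) ^ N * to_fract (u ^ N * f) = to_fract f"
    using u by (simp add: to_fract_power power_inverse)
  ultimately show "to_fract f \<in> ?L"
    by (simp only:)
qed

text \<open>The set below is $R[s]$. Polynomials are used as representatives because the formal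
  derivative is needed on them later.\<close>

lemma is_subring_poly_values:
  assumes R: "is_subring R"
  shows "is_subring {poly p s | p. \<forall>i. coeff p i \<in> R}" (is "is_subring ?P")
proof (rule is_subringI)
  have "\<forall>i. coeff (1 :: 'a poly) i \<in> R" "1 = poly 1 s"
    using is_subringD(1)[OF R] is_subring_zero[OF R] by (auto simp: of_bool_def)
  then show "1 \<in> ?P"
    by blast
next
  fix a b assume "a \<in> ?P" "b \<in> ?P"
  then obtain p q where p: "a = poly p s" "\<forall>i. coeff p i \<in> R" 
    and q: "b = poly q s" "\<forall>i. coeff q i \<in> R"
    by blast
  have "a + b = poly (p + q) s" "\<forall>i. coeff (p + q) i \<in> R"
    using p q by (auto intro: is_subringD[OF R])
  then show "a + b \<in> ?P"
    by blast
  have "a * b = poly (p * q) s" "\<forall>i. coeff (p * q) i \<in> R"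
    using p q by (auto simp: coeff_mult intro!: is_subring_sum[OF R] is_subringD(3)[OF R])
  then show "a * b \<in> ?P"
    by blast
next
  fix a assume "a \<in> ?P"
  then obtain p where p: "a = poly p s" "\<forall>i. coeff p i \<in> R"
    by blast
  then have "- a = poly (- p) s" "\<forall>i. coeff (- p) i \<in> R"
    by (auto intro: is_subringD[OF R])
  then show "- a \<in> ?P"
    by blast
qed

section \<open>Derivations and their kernels\<close>

locale ring_derivation =
  fixes d :: "'a::{idom, ring_char_0} \<Rightarrow> 'a"
  assumes add: "d (a + b) = d a + d b"
    and mult: "d (a * b) = d a * b + a * d b"
begin

lemma zero [simp]: "d 0 = 0"
  using add[of 0 0] by simp

lemma one [simp]: "d 1 = 0"
  using mult[of 1 1] by simp

lemma uminus: "d (- a) = - d a"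
  using add[of a "- a"] by (simp add: eq_neg_iff_add_eq_0 add.commute)

lemma sum: "d (sum f I) = (\<Sum>i\<in>I. d (f i))"
  by (induction I rule: infinite_finite_induct) (simp_all add: add)

lemma is_subring_kernel: "is_subring {a. d a = 0}"
  by (intro is_subringI) (auto simp: add mult uminus)

lemma of_nat [simp]: "d (of_nat k) = 0"
  using is_subring_of_nat[OF is_subring_kernel] by blast

lemma sign [simp]: "d ((- 1) ^ k) = 0"
  using is_subring_power[OF is_subring_kernel, of "- 1" k] by (simp add: uminus)

lemma power: "d (a ^ k) = of_nat k * a ^ (k - 1) * d a"
proof (induction k)
  case (Suc k)
  then show ?case
    by (cases k) (simp_all add: mult algebra_simps)
qed simp

text \<open>The chain rule: coefficients in the kernel behave as constants.\<close>

lemma poly_eq: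
  assumes "\<And>i. d (coeff p i) = 0"
  shows "d (poly p s) = poly (pderiv p) s * d s"
  using assms
proof (induction p)
  case (pCons a p)
  have "d (coeff p i) = 0" for i
    using pCons.prems[of "Suc i"] by simp
  then show ?case
    using pCons.IH pCons.prems[of 0] by (simp add: pderiv_pCons add mult algebra_simps)
qed simp

text \<open>A nontrivial relation for \<open>s\<close> over the kernel has positive degree. Differentiation would
  give one of smaller degree, which is still nontrivial because the characteristic is 0.\<close>

lemma transcendental_over_kernel:
  assumes s: "d s \<noteq> 0" and p: "\<And>i. d (coeff p i) = 0" "poly p s = 0"
  shows "p = 0"
  using p
proof (induction "degree p" arbitrary: p rule: less_induct)
  case (less p)
  have "poly (pderiv p) s = 0"
    using poly_eq[OF less.prems(1), of s] less.prems(2) s by simp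
  moreover have "d (coeff (pderiv p) i) = 0" for i
    using less.prems(1) by (simp add: coeff_pderiv mult add)
  moreover have "degree (pderiv p) < degree p" if "degree p \<noteq> 0"
    using that by (simp add: degree_pderiv)
  ultimately have "degree p \<noteq> 0 \<Longrightarrow> pderiv p = 0"
    using less.hyps by blast
  then have "degree p = 0"
    using pderiv_eq_0_iff by blast
  then obtain c where "p = [:c:]"
    by (rule degree_eq_zeroE)
  then show ?case
    using less.prems(2) by simp
qed

text \<open>By the chain rule the derivative of \<open>p\<close> vanishes at \<open>s\<close>, so it is the zero polynomial by
  transcendence of \<open>s\<close>, and \<open>p\<close> is constant.\<close>

lemma kernel_poly_value:
  assumes s: "d s \<noteq> 0" and p: "\<And>i. d (coeff p i) = 0" and "d (poly p s) = 0"
  shows "poly p s = coeff p 0"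
proof -
  have "poly (pderiv p) s = 0"
    using poly_eq[OF p, of s] assms(3) s by simp
  moreover have "d (coeff (pderiv p) i) = 0" for i
    using p by (simp add: coeff_pderiv mult add)
  ultimately have "pderiv p = 0"
    using transcendental_over_kernel[OF s] by blast
  then obtain c where "p = [:c:]"
    by (meson pderiv_eq_0_iff degree_eq_zeroE)
  then show ?thesis
    by simp
qed

end

section \<open>Iterates of the Fibonacci derivation\<close>

text \<open>The derivation always produces $p\,x_p$ rather than $x_p$. Since this product vanishes at
  \<open>p = 0\<close>, truncated indices contribute nothing and the upper bounds of the sums below can be
  enlarged freely.\<close>

definition weighted_X :: "nat \<Rightarrow> cpoly" where
  "weighted_X p = of_nat p * X p"

lemma weighted_X_0 [simp]: "weighted_X 0 = 0"
  by (simp add: weighted_X_def)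

text \<open>This is $D^{j+1}(x_m) / j!$. The exponent is shifted by one because the binomial
  coefficients in $D^k(x_m)$ have lower index $k - 1$.\<close>

definition scaled_iterate :: "nat \<Rightarrow> nat \<Rightarrow> cpoly" where
  "scaled_iterate m j =
     (\<Sum>i\<le>m. (-1) ^ i * of_nat ((i + j choose j) * (m - i - 1 choose j))
        * weighted_X (m - (j + 1) - 2 * i))"

lemma sum_weighted_X_truncate:
  assumes "p \<le> 2 * M + 2" "M \<le> M'"
  shows "(\<Sum>i\<le>M'. c i * weighted_X (p - 2 * i)) = (\<Sum>i\<le>M. c i * weighted_X (p - 2 * i))"
  using assms by (intro sum.mono_neutral_right) auto

lemma Suc_times_choose_Suc: "Suc j * (j + q choose Suc j) = q * (j + q choose j)"
proof -
  have "Suc j * (Suc (j + q) choose Suc j) = Suc (j + q) * (j + q choose j)"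
    by (rule Suc_times_binomial)
  then show ?thesis
    by (simp add: algebra_simps)
qed

text \<open>The induction is on the number of summands. Put \<open>p = m - l - 2\<close>, $A = \binom{l+1+j}{j}$ and
  $B = \binom{p}{j}$. Each binomial coefficient with lower index \<open>j + 1\<close> is, up to the factor
  \<open>j + 1\<close>, a multiple of \<open>A\<close> or \<open>B\<close>, so the step from \<open>l\<close> to \<open>l + 1\<close> reduces to
  $(l+1)(p+1) + (j+1)(p-j-l-1) = (l+j+2)(p-j)$.\<close>

lemma sum_choose_product:
  assumes "2 * l + j + 1 \<le> m"
  shows "(\<Sum>i\<le>l. (m - (j + 1) - 2 * i) * ((i + j choose j) * (m - i - 1 choose j)))
    = Suc j * ((l + Suc j choose Suc j) * (m - l - 1 choose Suc j))"
  using assms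
proof (induction l)
  case 0
  then obtain q where m: "m = Suc (j + q)"
    by (metis add_Suc_right add_0 le_Suc_ex Suc_eq_plus1 add_Suc mult_0_right)
  show ?case
    using Suc_times_choose_Suc[of j q] by (simp add: m)
next
  case (Suc l)
  from Suc.prems obtain r where m: "m = 2 * Suc l + j + 1 + r"
    using le_Suc_ex by blast
  define q where "q = Suc l + r"
  define A where "A = (Suc l + j choose j)"
  define B where "B = (j + q choose j)"
  have A1: "Suc j * (Suc l + Suc j choose Suc j) = (l + j + 2) * A"
    using Suc_times_binomial[of j "Suc l + j"] by (simp add: A_def)
  have A2: "Suc j * (l + Suc j choose Suc j) = Suc l * A"
    using Suc_times_choose_Suc[of j "Suc l"] by (simp add: A_def add.commute)
  have B1: "Suc j * (j + q choose Suc j) = q * B"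
    using Suc_times_choose_Suc[of j q] by (simp add: B_def)
  have B2: "Suc j * (Suc (j + q) choose Suc j) = (j + q + 1) * B"
    using Suc_times_binomial[of j "j + q"] by (simp add: B_def)
  have idx: "m - l - 1 = Suc (j + q)" "m - Suc l - 1 = j + q" "m - (j + 1) - 2 * Suc l = r"
    by (simp_all add: m q_def)
  have IH: "(\<Sum>i\<le>l. (m - (j + 1) - 2 * i) * ((i + j choose j) * (m - i - 1 choose j)))
      = Suc j * ((l + Suc j choose Suc j) * (Suc (j + q) choose Suc j))"
    using Suc.IH Suc.prems idx by simp
  \<comment> \<open>The extra factor \<open>Suc j\<close> lets both binomial coefficients of a product absorb one.\<close>
  have "Suc j * (Suc j * ((l + Suc j choose Suc j) * (Suc (j + q) choose Suc j)) + r * (A * B))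
      = (Suc j * (l + Suc j choose Suc j)) * (Suc j * (Suc (j + q) choose Suc j))
        + Suc j * (r * (A * B))"
    by (simp only: algebra_simps)
  also have "\<dots> = Suc l * A * ((j + q + 1) * B) + Suc j * (r * (A * B))"
    by (simp only: A2 B2)
  also have "\<dots> = (l + j + 2) * A * (q * B)"
    by (simp add: q_def algebra_simps)
  also have "\<dots> = Suc j * (Suc j * ((Suc l + Suc j choose Suc j) * (j + q choose Suc j)))"
    by (simp only: A1[symmetric] B1[symmetric]) (simp only: mult_ac)
  finally have "Suc j * ((l + Suc j choose Suc j) * (Suc (j + q) choose Suc j)) + r * (A * B)
      = Suc j * ((Suc l + Suc j choose Suc j) * (j + q choose Suc j))"
    by (simp only: mult_cancel1) simp
  then show ?case
    using IH idx by (simp only: sum.atMost_Suc A_def B_def)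
qed

text \<open>A Fibonacci derivation is constrained only on polynomials in $x_0, \ldots, x_n$. An
  extension to all variables is a derivation of the whole ring, so that computations need no
  membership conditions; its values at $x_m$ for \<open>m > n\<close> are left open.\<close>

locale fibonacci_extension = ring_derivation d for d :: "cpoly \<Rightarrow> cpoly" +
  fixes n :: nat
  assumes Const: "d (Const c) = 0" and X_0: "d (X 0) = 0" and X_1: "d (X 1) = 0"
    and X_fibonacci: "m \<in> {2..n} \<Longrightarrow> d (X m) =
        (\<Sum>k = 0..(m - 1) div 2. (-1) ^ k * of_nat (m - 1 - 2 * k) * X (m - 1 - 2 * k))"
begin

lemma X_1_power: "d (X 1 ^ k) = 0"
  by (simp only: power X_1 mult_zero_right)

lemma X_eq:
  assumes "m \<le> n" "m \<le> 2 * M + 3"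
  shows "d (X m) = (\<Sum>i\<le>M. (-1) ^ i * weighted_X (m - 1 - 2 * i))"
proof -
  consider "m = 0" | "m = 1" | "m \<in> {2..n}"
    using assms(1) by fastforce
  then show ?thesis
  proof cases
    case 3
    let ?M = "(m - 1) div 2"
    have "d (X m) = (\<Sum>i\<le>?M. (-1) ^ i * weighted_X (m - 1 - 2 * i))"
      using 3 by (simp add: X_fibonacci weighted_X_def atMost_atLeast0 mult.assoc)
    also have "\<dots> = (\<Sum>i\<le>?M + M. (-1) ^ i * weighted_X (m - 1 - 2 * i))"
      by (rule sum_weighted_X_truncate[symmetric]) auto
    also have "\<dots> = (\<Sum>i\<le>M. (-1) ^ i * weighted_X (m - 1 - 2 * i))"
      using assms(2) by (intro sum_weighted_X_truncate) auto
    finally show ?thesis .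
  qed (use X_0 X_1 in simp_all)
qed

lemma X_eq_scaled_iterate: "m \<le> n \<Longrightarrow> d (X m) = scaled_iterate m 0"
  using X_eq[of m m] by (simp add: scaled_iterate_def)

text \<open>Applying the derivation to each $x_p$ in the sum gives a double sum in which the index
  of the variable depends only on \<open>i + k\<close>. Collecting along these diagonals leaves the inner sum of
  \<open>sum_choose_product\<close>.\<close>

lemma scaled_iterate:
  assumes "m \<le> n"
  shows "d (scaled_iterate m j) = of_nat (Suc j) * scaled_iterate m (Suc j)"
proof -
  define b where "b i = (i + j choose j) * (m - i - 1 choose j)" for i
  define p where "p i = m - (j + 1) - 2 * i" for i
  define Y where "Y l = weighted_X (m - (Suc j + 1) - 2 * l)" for l
  have "d (scaled_iterate m j) = (\<Sum>i\<le>m. (-1) ^ i * of_nat (b i) * (of_nat (p i) * d (X (p i))))"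
    by (simp add: scaled_iterate_def sum mult weighted_X_def b_def p_def)
  also have "\<dots> = (\<Sum>i\<le>m. \<Sum>k\<le>m - i. (-1) ^ (i + k) * of_nat (p i * b i) * Y (i + k))"
  proof (rule sum.cong[OF refl])
    fix i assume "i \<in> {..m}"
    then have "d (X (p i)) = (\<Sum>k\<le>m - i. (-1) ^ k * weighted_X (p i - 1 - 2 * k))"
      using assms by (intro X_eq) (auto simp: p_def)
    also have "\<dots> = (\<Sum>k\<le>m - i. (-1) ^ k * Y (i + k))"
      by (simp add: p_def Y_def algebra_simps)
    finally show "(-1) ^ i * of_nat (b i) * (of_nat (p i) * d (X (p i)))
        = (\<Sum>k\<le>m - i. (-1) ^ (i + k) * of_nat (p i * b i) * Y (i + k))"
      by (simp add: sum_distrib_left power_add mult_ac)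
  qed
  also have "\<dots> = (\<Sum>(i, k) \<in> {(i, k). i + k \<le> m}. (-1) ^ (i + k) * of_nat (p i * b i) * Y (i + k))"
  proof -
    have "{(i, k). i + k \<le> m} = Sigma {..m} (\<lambda>i. {..m - i})"
      by auto
    then show ?thesis
      by (simp add: sum.Sigma)
  qed
  also have "\<dots> = (\<Sum>l\<le>m. \<Sum>i\<le>l. (-1) ^ l * of_nat (p i * b i) * Y l)"
    by (simp add: sum.triangle_reindex_eq)
  also have "\<dots> = (\<Sum>l\<le>m. (-1) ^ l * of_nat (\<Sum>i\<le>l. p i * b i) * Y l)"
    by (simp add: sum_distrib_left sum_distrib_right)
  also have "\<dots> = (\<Sum>l\<le>m. of_nat (Suc j) * ((-1) ^ l
      * of_nat ((l + Suc j choose Suc j) * (m - l - 1 choose Suc j)) * Y l))"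
  proof (rule sum.cong[OF refl])
    fix l
    show "(-1) ^ l * of_nat (\<Sum>i\<le>l. p i * b i) * Y l = of_nat (Suc j) * ((-1) ^ l
      * of_nat ((l + Suc j choose Suc j) * (m - l - 1 choose Suc j)) * Y l)"
    \<comment> \<open>Otherwise the index is truncated to 0 and the weight is 0.\<close>
    proof (cases "2 * l + j + 1 \<le> m")
      case True
      have "(\<Sum>i\<le>l. p i * b i) = Suc j * ((l + Suc j choose Suc j) * (m - l - 1 choose Suc j))"
        using sum_choose_product[OF True] by (simp only: p_def b_def)
      then show ?thesis
        by (simp only: of_nat_mult mult_ac)
    next
      case False
      then show ?thesis
        by (simp add: Y_def)
    qed
  qed
  finally show ?thesis
    unfolding scaled_iterate_def Y_def by (simp only: sum_distrib_left)
qed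

end

text \<open>This exhibits $C_m$ as the series $\sum_k \frac{(-1)^k}{k!} D^k(x_m) x_2^k x_1^{m-2-k}$, in
  which the terms \<open>k = m - 2\<close> and \<open>k = m - 1\<close> are both multiples of $x_2^{m-1}$ and have been
  merged into the last summand.\<close>

lemma Cpoly_eq:
  assumes "3 \<le> m"
  shows "Cpoly m = X m * X 1 ^ (m - 2)
    + (\<Sum>k = 1..m - 3. Const (1 / of_nat k) * ((-1) ^ k * scaled_iterate m (k - 1))
         * X 2 ^ k * X 1 ^ (m - 2 - k))
    + of_nat (m - 2) * (-1) ^ (m - 2) * X 2 ^ (m - 1)"
proof -
  have "(\<Sum>i = 0..(m - k) div 2.
             (-1) ^ (k + i) * of_nat (m - k - 2 * i)
             * of_nat ((i + k - 1) choose (k - 1)) * of_nat ((m - i - 1) choose (k - 1))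
             * X (m - k - 2 * i) * X 2 ^ k * X 1 ^ (m - 2 - k))
      = (-1) ^ k * scaled_iterate m (k - 1) * X 2 ^ k * X 1 ^ (m - 2 - k)"
    if k: "1 \<le> k" for k
  proof -
    define c :: "nat \<Rightarrow> cpoly" where
      "c i = (-1) ^ i * of_nat ((i + (k - 1) choose (k - 1)) * (m - i - 1 choose (k - 1)))" for i
    have "scaled_iterate m (k - 1) = (\<Sum>i\<le>m. c i * weighted_X (m - k - 2 * i))"
      using k by (simp add: scaled_iterate_def c_def)
    also have "\<dots> = (\<Sum>i\<le>(m - k) div 2. c i * weighted_X (m - k - 2 * i))"
      by (rule sum_weighted_X_truncate) auto
    finally have *: "scaled_iterate m (k - 1)
        = (\<Sum>i = 0..(m - k) div 2. c i * weighted_X (m - k - 2 * i))"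
      by (simp only: atMost_atLeast0)
    have **: "i + k - 1 = i + (k - 1)" for i
      using k by simp
    show ?thesis
      unfolding * sum_distrib_left sum_distrib_right
      by (intro sum.cong refl) (simp only: ** c_def weighted_X_def power_add of_nat_mult mult_ac)
  qed
  then show ?thesis
    unfolding Cpoly_def by (simp add: mult.assoc)
qed

context fibonacci_extension
begin

lemma X_2: "2 \<le> n \<Longrightarrow> d (X 2) = X 1"
  using X_fibonacci[of 2] by (simp add: numeral_2_eq_2)

text \<open>Besides $x_2$ only $x_0$ could occur in $D^{m-2}(x_m)$, and its weight is 0.\<close>

lemma scaled_iterate_near_top:
  assumes "3 \<le> m"
  shows "scaled_iterate m (m - 3) = of_nat ((m - 1) * (m - 2)) * X 2"
proof -
  have "scaled_iterate m (m - 3)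
      = (\<Sum>i\<le>0. (-1) ^ i * of_nat ((i + (m - 3) choose (m - 3)) * (m - i - 1 choose (m - 3)))
          * weighted_X (2 - 2 * i))"
    unfolding scaled_iterate_def using assms
    by (subst sum_weighted_X_truncate[of 2 0 m, symmetric]) (auto intro!: sum.cong)
  also have "\<dots> = of_nat ((m - 1 choose (m - 3)) * 2) * X 2"
    by (simp add: weighted_X_def mult.assoc)
  also have "(m - 1 choose (m - 3)) * 2 = (m - 1) * (m - 2)"
  proof -
    obtain k where m: "m = k + 3"
      using assms by (metis add.commute le_Suc_ex)
    have "(k + 2 choose k) = (k + 2 choose 2)"
      using binomial_symmetric[of k "k + 2"] by simp
    moreover have "(k + 2 choose 2) * 2 = (k + 2) * (k + 1)"
      by (simp add: choose_two)
    ultimately show ?thesis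
      by (simp add: m)
  qed
  finally show ?thesis .
qed

text \<open>The Leibniz rule gives two terms for each \<open>k\<close>: one with the next iterate of $x_m$ and one with
  a lowered power of $x_2$. The second cancels the first term for \<open>k - 1\<close>; what is left at the two
  ends cancels against the first and last summand of $C_m$.\<close>

lemma Cpoly:
  assumes m: "3 \<le> m" "m \<le> n"
  shows "d (Cpoly m) = 0"
proof -
  define T where "T k = (-1) ^ k * scaled_iterate m k * X 2 ^ k * X 1 ^ (m - 2 - k)" for k
  have step: "d (Const (1 / of_nat k) * ((-1) ^ k * scaled_iterate m (k - 1))
         * X 2 ^ k * X 1 ^ (m - 2 - k)) = T k - T (k - 1)" if k: "k \<in> {1..m - 3}" for k
  proof -
    obtain j where j: "k = Suc j"
      using k by (cases k) auto
    define P :: cpoly where "P = X 1 ^ (m - 2 - Suc j)"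
    have "m - 2 - j = Suc (m - 2 - Suc j)"
      using k m j by auto
    then have e: "X 1 ^ (m - 2 - j) = X 1 * P"
      by (simp only: P_def power_Suc)
    have c: "Const (1 / of_nat (Suc j)) * of_nat (Suc j) = 1"
      by (simp del: of_nat_Suc flip: Const_of_nat Const_mult)
    have "d (Const (1 / of_nat k) * ((-1) ^ k * scaled_iterate m (k - 1))
          * X 2 ^ k * X 1 ^ (m - 2 - k))
       = (Const (1 / of_nat (Suc j)) * of_nat (Suc j))
         * ((-1) ^ k * scaled_iterate m k * X 2 ^ k * X 1 ^ (m - 2 - k)
         + (-1) ^ k * scaled_iterate m j * (X 2 ^ j * X 1) * X 1 ^ (m - 2 - k))"
      using m unfolding j
      by (simp only: mult Const sign power[of "X 2"] X_1_power X_2 scaled_iterate diff_Suc_1)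
        (simp only: algebra_simps mult_zero_left mult_zero_right
          add_0_left add_0_right)
    also have "\<dots> = T k - T (k - 1)"
      unfolding c T_def j diff_Suc_1 e P_def[symmetric] power_Suc by (simp add: algebra_simps)
    finally show ?thesis .
  qed
  have "(\<Sum>k = 1..m - 3. T k - T (k - 1)) = T (m - 3) - T 0"
    using sum_telescope''[of 0 "m - 3" T] by simp
  then have mid: "d (\<Sum>k = 1..m - 3. Const (1 / of_nat k) * ((-1) ^ k * scaled_iterate m (k - 1))
         * X 2 ^ k * X 1 ^ (m - 2 - k)) = T (m - 3) - T 0"
    unfolding sum using step by simp
  have first: "d (X m * X 1 ^ (m - 2)) = T 0"
    using m by (simp add: mult X_1_power X_eq_scaled_iterate T_def del: One_nat_def)
  obtain r where r: "m = r + 3"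
    using m by (metis add.commute le_Suc_ex)
  have last: "d (of_nat (m - 2) * (-1) ^ (m - 2) * X 2 ^ (m - 1)) = - T (m - 3)"
  proof -
    have "d (of_nat (m - 2) * (-1) ^ (m - 2) * X 2 ^ (m - 1))
        = of_nat (m - 2) * (-1) ^ (m - 2) * (of_nat (m - 1) * X 2 ^ (m - 1 - 1) * X 1)"
      using m by (simp only: mult of_nat sign power[of "X 2"] X_2) simp
    also have "\<dots> = - T (m - 3)"
      unfolding T_def scaled_iterate_near_top[OF m(1)] by (simp add: r algebra_simps)
    finally show ?thesis .
  qed
  show ?thesis
    unfolding Cpoly_eq[OF m(1)] add first mid last by simp
qed

end

section \<open>The kernel of the Fibonacci derivation\<close>

abbreviation (input) kernel_generators :: "nat \<Rightarrow> cpoly set" where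
  "kernel_generators n \<equiv> {X 0, X 1} \<union> Cpoly ` {3..n}"

lemma X_neq_0: "X i \<noteq> 0"
proof
  assume "X i = 0"
  then have "Poly_Mapping.lookup (X i) (Poly_Mapping.single i 1) = 0"
    by simp
  then show False
    by (simp add: X_def lookup_single)
qed

text \<open>The equation for $C_m$ is solved for $x_1^{m-2} x_m$ in terms of $C_m$ and variables of smaller
  index. The induction runs in the subring \<open>G\<close> of elements that reach \<open>R\<close> after multiplication by
  some power of $x_1$, in which that equation can be divided by $x_1^{m-2}$.\<close>

lemma X_eventually_in_adjoin:
  assumes R: "is_subring R" "range Const \<subseteq> R" "X 0 \<in> R" "X 1 \<in> R" "X 2 \<in> R"
    and C: "\<And>k. k \<in> {3..m} \<Longrightarrow> Cpoly k \<in> R"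
  shows "\<exists>N. X 1 ^ N * X m \<in> R"
  using C
proof (induction m rule: less_induct)
  case (less m)
  define G where "G = {f. \<exists>N. X 1 ^ N * f \<in> R}"
  have G: "is_subring G"
    unfolding G_def by (intro is_subring_clear_denominators R)
  have RG: "f \<in> G" if "f \<in> R" for f
    using that unfolding G_def by (auto intro: exI[of _ 0])
  show ?case
  proof (cases "m < 3")
    case True
    then have "m = 0 \<or> m = 1 \<or> m = 2"
      by auto
    then have "X m \<in> R"
      using R by auto
    then show ?thesis
      using RG by (auto simp: G_def)
  next
    case False
    have Xk: "X k \<in> G" if "k < m" for k
      using less.IH[OF that] less.prems that by (auto simp: G_def)
    have wX: "weighted_X k \<in> G" if "k < m" for k
      unfolding weighted_X_def by (intro is_subringD(3)[OF G] is_subring_of_nat[OF G] Xk that)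
    have sgn: "(-1) ^ k \<in> G" for k
      by (intro is_subring_power[OF G] is_subringD[OF G])
    have it: "scaled_iterate m j \<in> G" for j
      unfolding scaled_iterate_def using False
      by (intro is_subring_sum[OF G] is_subringD(3)[OF G] is_subring_of_nat[OF G] wX sgn) auto
    define rest where "rest = (\<Sum>k = 1..m - 3. Const (1 / of_nat k)
        * ((-1) ^ k * scaled_iterate m (k - 1)) * X 2 ^ k * X 1 ^ (m - 2 - k))
      + of_nat (m - 2) * (-1) ^ (m - 2) * X 2 ^ (m - 1)"
    have "Const c \<in> G" for c
      using R(2) by (intro RG) auto
    moreover have "X 1 \<in> G" "X 2 \<in> G"
      using R by (auto intro: RG)
    ultimately have "rest \<in> G"
      unfolding rest_def
      by (intro is_subringD(2)[OF G] is_subring_sum[OF G] is_subringD(3)[OF G]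
        is_subring_of_nat[OF G] is_subring_power[OF G] sgn it) auto
    moreover have "Cpoly m \<in> G"
      using less.prems[of m] False by (intro RG) auto
    ultimately have "Cpoly m - rest \<in> G"
      by (intro is_subring_diff[OF G])
    moreover have "Cpoly m - rest = X 1 ^ (m - 2) * X m"
      using False by (simp add: Cpoly_eq rest_def)
    ultimately obtain N where "X 1 ^ N * (X 1 ^ (m - 2) * X m) \<in> R"
      by (auto simp: G_def)
    then have "X 1 ^ (N + (m - 2)) * X m \<in> R"
      by (simp add: power_add mult.assoc)
    then show ?thesis
      by blast
  qed
qed

lemma cpolys_eventually_poly_X_2:
  assumes A: "is_subring A" "range Const \<subseteq> A" "kernel_generators n \<subseteq> A"
    and f: "f \<in> cpolys n"
  shows "\<exists>N p. (\<forall>i. coeff p i \<in> A) \<and> X 1 ^ N * f = poly p (X 2)"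
proof -
  define R where "R = {poly p (X 2) | p. \<forall>i. coeff p i \<in> A}"
  have R: "is_subring R"
    unfolding R_def by (rule is_subring_poly_values[OF A(1)])
  have AR: "a \<in> R" if "a \<in> A" for a
    unfolding R_def using that is_subring_zero[OF A(1)]
    by (auto intro!: exI[of _ "[:a:]"] simp: coeff_pCons split: nat.split)
  have X2: "X 2 \<in> R"
    unfolding R_def using is_subring_zero[OF A(1)] is_subringD(1)[OF A(1)]
    by (auto intro!: exI[of _ "[:0, 1:]"] simp: coeff_pCons split: nat.split)
  have CR: "range Const \<subseteq> R" and XR: "X 0 \<in> R" "X 1 \<in> R"
    using A AR by auto
  have "is_subring {g. \<exists>N. X 1 ^ N * g \<in> R}"
    by (intro is_subring_clear_denominators R XR)
  moreover have "range Const \<subseteq> {g. \<exists>N. X 1 ^ N * g \<in> R}"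
    using CR by (auto intro!: exI[of _ 0])
  moreover have "X ` {0..n} \<subseteq> {g. \<exists>N. X 1 ^ N * g \<in> R}"
  proof safe
    fix m assume "m \<in> {0..n}"
    then show "\<exists>N. X 1 ^ N * X m \<in> R"
      using A(3) AR by (intro X_eventually_in_adjoin R CR XR X2) (auto simp: image_subset_iff)
  qed
  ultimately have "cpolys n \<subseteq> {g. \<exists>N. X 1 ^ N * g \<in> R}"
    unfolding cpolys_eq_ring_adjoin by (rule ring_adjoin_least)
  then show ?thesis
    using f unfolding R_def by blast
qed

lemma fibonacci_derivation_extends:
  assumes "1 \<le> n" "fibonacci_derivation n D"
  obtains d where "fibonacci_extension d n" "\<And>f. f \<in> cpolys n \<Longrightarrow> d f = D f"
proof
  let ?d = "derivation_of (\<lambda>i. D (X i)) n"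
  have D: "is_derivation n D"
    using assms(2) by (simp add: fibonacci_derivation_def)
  then have d: "is_derivation n ?d"
    by (intro is_derivation_derivation_of) (auto simp: is_derivation_def cpolys_X)
  show eq: "?d f = D f" if "f \<in> cpolys n" for f
    using derivation_unique[OF d D _ that] by (simp add: derivation_of_X)
  show "fibonacci_extension ?d n"
  proof
    show "?d (Const c) = 0" for c
      using derivation_Const[OF d] .
    show "?d (X 0) = 0" "?d (X 1) = 0"
      using assms by (simp_all add: derivation_of_X fibonacci_derivation_def)
    show "?d (X m) =
        (\<Sum>k = 0..(m - 1) div 2. (-1) ^ k * of_nat (m - 1 - 2 * k) * X (m - 1 - 2 * k))"
      if "m \<in> {2..n}" for m
      using assms(2) that by (simp add: derivation_of_X fibonacci_derivation_def)
  qed (rule derivation_of_add derivation_of_mult)+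
qed

context fibonacci_extension
begin

text \<open>Both directions multiply by $x_1^N$, a kernel element that is not a zero divisor. The case
  \<open>n = 1\<close> is separate since there $x_2$ is absent and the derivation has no slice: the adjoined
  ring is then all of $\mathbf{C}[x_0, x_1]$.\<close>

lemma kernel_iff:
  assumes n: "1 \<le> n" and f: "f \<in> cpolys n"
  shows "d f = 0 \<longleftrightarrow> (\<exists>N. X 1 ^ N * f \<in> ring_adjoin (range Const) (kernel_generators n))"
    (is "_ \<longleftrightarrow> (\<exists>N. _ \<in> ?A)")
proof
  have A: "is_subring ?A"
    by (intro is_subring_ring_adjoin) (metis Const_1 rangeI)
  have "?A \<subseteq> {a. d a = 0}"
    by (intro ring_adjoin_least is_subring_kernel) (auto simp: Const X_0 X_1[simplified] Cpoly)
  then have kerA: "d a = 0" if "a \<in> ?A" for a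
    using that by blast
  show "d f = 0" if "\<exists>N. X 1 ^ N * f \<in> ?A"
  proof -
    obtain N where "d (X 1 ^ N * f) = 0"
      using \<open>\<exists>N. X 1 ^ N * f \<in> ?A\<close> kerA by blast
    then have "X 1 ^ N * d f = 0"
      by (simp only: mult X_1_power mult_zero_left add_0_left)
    then show ?thesis
      by (simp add: X_neq_0)
  qed
  assume df: "d f = 0"
  show "\<exists>N. X 1 ^ N * f \<in> ?A"
  proof (cases "n = 1")
    case True
    have "{0..1} = {0, 1::nat}"
      by auto
    then have "f \<in> ?A"
      using f True by (simp add: cpolys_eq_ring_adjoin)
    then show ?thesis
      by (intro exI[of _ 0]) simp
  next
    case False
    then have slice: "d (X 2) \<noteq> 0"
      using n by (simp add: X_2 X_neq_0)
    have "range Const \<subseteq> ?A" "kernel_generators n \<subseteq> ?A"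
      by (auto intro: ring_adjoin.base ring_adjoin.gen)
    from cpolys_eventually_poly_X_2[OF A this f]
    obtain N p where p: "\<And>i. coeff p i \<in> ?A" "X 1 ^ N * f = poly p (X 2)"
      by blast
    have "d (X 1 ^ N * f) = 0"
      by (simp only: mult X_1_power df mult_zero_left mult_zero_right add_0_left)
    then have "poly p (X 2) = coeff p 0"
      using p kerA by (intro kernel_poly_value[OF slice]) simp_all
    then show ?thesis
      using p by metis
  qed
qed

end

theorem theorem2p3:
  fixes n :: nat and D :: "cpoly \<Rightarrow> cpoly"
  assumes "n \<ge> 1"
    and "fibonacci_derivation n D"
  shows "to_fract ` derivation_kernel n D =
    ring_adjoin (to_fract ` ring_adjoin (range Const) ({X 0, X 1} \<union> Cpoly ` {3..n}))
      {inverse (to_fract (X 1))}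
    \<inter> to_fract ` cpolys n"
proof -
  let ?A = "ring_adjoin (range Const) (kernel_generators n)"
  obtain d where "fibonacci_extension d n" and d: "\<And>f. f \<in> cpolys n \<Longrightarrow> d f = D f"
    using fibonacci_derivation_extends[OF assms] by blast
  then interpret fibonacci_extension d n
    by simp
  have "is_subring ?A"
    by (intro is_subring_ring_adjoin) (metis Const_1 rangeI)
  moreover have "X 1 \<in> ?A"
    by (auto intro: ring_adjoin.gen)
  ultimately have "to_fract f \<in> ring_adjoin (to_fract ` ?A) {inverse (to_fract (X 1))}
      \<longleftrightarrow> D f = 0" if "f \<in> cpolys n" for f
    using that kernel_iff[OF assms(1) that] d
    by (simp add: to_fract_mem_localisation_iff X_neq_0)
  then show ?thesis
    by (auto simp: derivation_kernel_def)
qed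

end
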